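(* Let $G$ be a semisimple compact matrix Lie group with Cartan decomposition $\mathfrak g=\mathfrak t\oplus\mathfrak p$, $K$ the subgroup corresponding to $\mathfrak t$, $G_0=K\ltimes\mathfrak p$ the associated Cartan motion group, $\lambda\ge1$, and $\Psi_\lambda\colon G_0\to G$, $\Psi_\lambda(k,v)=\exp(v/\lambda)k$, the contraction map. Let $\{Q_i\}_{i=1}^n\subset G$ be a solution of the compact synchronization step (over $G$) of the algorithm of synchronization via contraction described in the context, and denote the Cartan decomposition in $G$ of each of its elements by $Q_i=\exp(v_i)k_i$, with $v_i\in\mathfrak p$, $k_i\in K$. Then the output of the algorithm is invariant to any global alignment $Q\in G$ with Cartan decomposition $Q=\exp(v)k$, $v\in\mathfrak p$, $k\in K$, such that $\mathrm{Ad}_{k_i}(v)$ commutes with $v_i$ (i.e. $[\mathrm{Ad}_{k_i}(v),v_i]=0$) for $i=1,\dots,n$. Here invariance means that for all $i,j$, $$\Psi_\lambda^{-1}(Q_iQ)\,\Psi_\lambda^{-1}\left((Q_jQ)^{-1}\right)=\Psi_\lambda^{-1}(Q_i)\,\left(\Psi_\lambda^{-1}(Q_j)\right)^{-1}.$$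
   Context: Setting. $G$ is a semisimple compact Lie group identified with a group of orthogonal matrices via a faithful orthogonal representation. $\mathfrak{g}=\mathfrak{t}\oplus\mathfrak{p}$ is the decomposition of its Lie algebra into the $+1$ eigenspace $\mathfrak{t}$ and $-1$ eigenspace $\mathfrak{p}$ of a Cartan involution; $K$ is the Lie subgroup of $G$ with Lie algebra $\mathfrak t$; $\mathrm{Ad}_k(v)=kvk^{-1}$ preserves $\mathfrak p$ for $k\in K$. $G_0=K\ltimes \mathfrak p$ has product $(k_1,v_1)(k_2,v_2)=(k_1k_2,\,v_1+\mathrm{Ad}_{k_1}(v_2))$. A (global) Cartan decomposition of an element of $G$ is a factorization $\exp(w)k$ with $w\in\mathfrak p$, $k\in K$. The back mapping $\Psi_\lambda^{-1}$ is the inverse of $\Psi_\lambda$: it sends an element with Cartan decomposition $\exp(w)k$ to $(k,\lambda w)\in G_0$. Algorithm. Synchronization over $G_0$ means estimating $g_1,\dots,g_n\in G_0$ from (noisy, partial) measurements $g_{ij}$ of the ratios $g_ig_j^{-1}$. The algorithm maps the measurements to $\Psi_\lambda(g_{ij})\in G$, solves the synchronization problem over the compact group $G$ with these measurements to obtain $Q_1,\dots,Q_n\in G$ (determined only up to a global alignment $Q_i\mapsto Q_iQ$, $Q\in G$), chooses a global alignment $Q\in G$, and outputs $\hat g_i=\Psi_\lambda^{-1}(Q_iQ)$, $i=1,\dots,n$. Solutions of synchronization are determined only up to right multiplication by a common group element, so any cost function based on the distance between $g_{ij}$ and the ratios of the estimated elements depends only on these ratios.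
   Formalization: Cartan decompositions in a compact group are not unique, so the identity is proved when all v_i and v_i+Ad_{k_i}(v) lie in a symmetric Ad(K)-invariant region of p where they are unique, and without that condition for suitable values of a multivalued inverse of Psi_lambda. *)

theory Defs
  imports "HOL-Analysis.Analysis" "HOL-Algebra.Group"
begin

type_synonym 'n sqmat = "real ^ 'n ^ 'n"

text \<open>The type \<open>real ^ 'n ^ 'n\<close> carries the componentwise product, so the library functions
  \<open>exp\<close> and \<open>^\<close> are not the matrix ones.\<close>

definition mexp :: "'n::finite sqmat \<Rightarrow> 'n sqmat" where
  "mexp A = (\<Sum>m. ((\<lambda>B. A ** B) ^^ m) (mat 1) /\<^sub>R fact m)"

definition lie_bracket :: "'n::finite sqmat \<Rightarrow> 'n sqmat \<Rightarrow> 'n sqmat" where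
  "lie_bracket X Y = X ** Y - Y ** X"

definition Ad :: "'n::finite sqmat \<Rightarrow> 'n sqmat \<Rightarrow> 'n sqmat" where
  "Ad k v = k ** v ** matrix_inv k"

definition orthogonal_matrix_group :: "'n::finite sqmat set \<Rightarrow> bool" where
  "orthogonal_matrix_group G \<longleftrightarrow>
     (\<forall>A\<in>G. orthogonal_matrix A) \<and> mat 1 \<in> G \<and>
     (\<forall>A\<in>G. \<forall>B\<in>G. A ** B \<in> G) \<and> (\<forall>A\<in>G. matrix_inv A \<in> G)"

text \<open>Every closed subgroup of a matrix group is a Lie group, and this is its Lie algebra.\<close>

definition lie_algebra_of :: "'n::finite sqmat set \<Rightarrow> 'n sqmat set" where
  "lie_algebra_of G = {X. \<forall>t::real. mexp (t *\<^sub>R X) \<in> G}"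

definition lie_ideal :: "'n::finite sqmat set \<Rightarrow> 'n sqmat set \<Rightarrow> bool" where
  "lie_ideal I L \<longleftrightarrow> subspace I \<and> I \<subseteq> L \<and> (\<forall>X\<in>L. \<forall>Y\<in>I. lie_bracket X Y \<in> I)"

definition derived_algebra :: "'n::finite sqmat set \<Rightarrow> 'n sqmat set" where
  "derived_algebra L = span {lie_bracket X Y | X Y. X \<in> L \<and> Y \<in> L}"

definition solvable_lie_algebra :: "'n::finite sqmat set \<Rightarrow> bool" where
  "solvable_lie_algebra L \<longleftrightarrow> (\<exists>m. (derived_algebra ^^ m) L = {0})"

definition semisimple_lie_algebra :: "'n::finite sqmat set \<Rightarrow> bool" where
  "semisimple_lie_algebra L \<longleftrightarrow>
     (\<forall>I. lie_ideal I L \<and> solvable_lie_algebra I \<longrightarrow> I = {0})"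

definition semisimple_compact_group :: "'n::finite sqmat set \<Rightarrow> bool" where
  "semisimple_compact_group G \<longleftrightarrow>
     orthogonal_matrix_group G \<and> compact G \<and> semisimple_lie_algebra (lie_algebra_of G)"

text \<open>A Cartan involution of a compact Lie algebra is an involutive automorphism, as usual for
  symmetric spaces of compact type.  (The definition for noncompact real forms, by definiteness
  of the Killing form twisted by \<open>\<theta>\<close>, would only allow the identity.)  Only the values of
  \<open>\<theta>\<close> on \<open>L\<close> matter.\<close>

definition cartan_involution ::
    "'n::finite sqmat set \<Rightarrow> ('n sqmat \<Rightarrow> 'n sqmat) \<Rightarrow> bool" where
  "cartan_involution L \<theta> \<longleftrightarrow>
     (\<forall>X\<in>L. \<theta> X \<in> L \<and> \<theta> (\<theta> X) = X) \<and>
     (\<forall>X\<in>L. \<forall>Y\<in>L. \<theta> (X + Y) = \<theta> X + \<theta> Y) \<and>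
     (\<forall>c. \<forall>X\<in>L. \<theta> (c *\<^sub>R X) = c *\<^sub>R \<theta> X) \<and>
     (\<forall>X\<in>L. \<forall>Y\<in>L. \<theta> (lie_bracket X Y) = lie_bracket (\<theta> X) (\<theta> Y))"

definition cartan_decomp :: "'n::finite sqmat set \<Rightarrow> 'n sqmat set \<Rightarrow> 'n sqmat set \<Rightarrow> bool" where
  "cartan_decomp L \<tt> \<pp> \<longleftrightarrow>
     (\<exists>\<theta>. cartan_involution L \<theta> \<and> \<tt> = {X\<in>L. \<theta> X = X} \<and> \<pp> = {X\<in>L. \<theta> X = - X})"

text \<open>\<open>K\<close> need not be connected; the connected subgroup generated by \<open>mexp ` \<tt>\<close> is one
  instance.\<close>

definition cartan_setting ::
    "'n::finite sqmat set \<Rightarrow> 'n sqmat set \<Rightarrow> 'n sqmat set \<Rightarrow> 'n sqmat set \<Rightarrow> bool" where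
  "cartan_setting G \<tt> \<pp> K \<longleftrightarrow>
     semisimple_compact_group G \<and>
     cartan_decomp (lie_algebra_of G) \<tt> \<pp> \<and>
     orthogonal_matrix_group K \<and> closed K \<and> K \<subseteq> G \<and> lie_algebra_of K = \<tt> \<and>
     (\<forall>k\<in>K. \<forall>v\<in>\<pp>. Ad k v \<in> \<pp>)"

definition motion_group ::
    "'n::finite sqmat set \<Rightarrow> 'n sqmat set \<Rightarrow> ('n sqmat \<times> 'n sqmat) monoid" where
  "motion_group K \<pp> =
     \<lparr>carrier = K \<times> \<pp>,
      mult = (\<lambda>(k1, v1) (k2, v2). (k1 ** k2, v1 + Ad k1 v2)),
      one = (mat 1, 0)\<rparr>"

definition contraction_map :: "real \<Rightarrow> 'n::finite sqmat \<times> 'n sqmat \<Rightarrow> 'n sqmat" where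
  "contraction_map lam = (\<lambda>(k, v). mexp (v /\<^sub>R lam) ** k)"

text \<open>In a compact group the factorization \<open>mexp w ** k\<close> is not unique, so the inverse of
  \<open>contraction_map lam\<close> has two versions.  \<open>back_values\<close> is the multivalued inverse, containing
  one value for each Cartan decomposition of its argument.  \<open>back_map\<close> is the single-valued
  inverse determined by a region \<open>U\<close> of \<open>\<pp>\<close> on which decompositions are unique, for instance a
  small ball around 0 in the Frobenius norm.\<close>

definition back_values ::
    "'n::finite sqmat set \<Rightarrow> 'n sqmat set \<Rightarrow> real \<Rightarrow> 'n sqmat \<Rightarrow> ('n sqmat \<times> 'n sqmat) set" where
  "back_values K \<pp> lam A = {(k, lam *\<^sub>R w) | k w. k \<in> K \<and> w \<in> \<pp> \<and> A = mexp w ** k}"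

definition cartan_domain ::
    "'n::finite sqmat set \<Rightarrow> 'n sqmat set \<Rightarrow> 'n sqmat set \<Rightarrow> bool" where
  "cartan_domain K \<pp> U \<longleftrightarrow>
     U \<subseteq> \<pp> \<and> (\<forall>w\<in>U. - w \<in> U) \<and> (\<forall>k\<in>K. \<forall>w\<in>U. Ad k w \<in> U) \<and>
     inj_on (\<lambda>(k, w). mexp w ** k) (K \<times> U)"

definition back_map ::
    "'n::finite sqmat set \<Rightarrow> 'n sqmat set \<Rightarrow> real \<Rightarrow> 'n sqmat \<Rightarrow> 'n sqmat \<times> 'n sqmat" where
  "back_map K U lam = the_inv_into (K \<times> (\<lambda>w. lam *\<^sub>R w) ` U) (contraction_map lam)"

end

theory Submission
  imports Defs
begin

text \<open>Put \<open>w\<^sub>i = v\<^sub>i + Ad k\<^sub>i v\<close>. Since \<open>k\<^sub>i exp(v) = exp(Ad k\<^sub>i v) k\<^sub>i\<close> and the exponents commute, \<open>Q\<^sub>i Q\<close> has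
  the Cartan decomposition \<open>exp(w\<^sub>i) (k\<^sub>i k)\<close>. In the motion group, \<open>(k\<^sub>i k, w\<^sub>i) (k\<^sub>j k, w\<^sub>j)\<^sup>-\<^sup>1\<close> has
  rotation part \<open>k\<^sub>i k\<^sub>j\<^sup>-\<^sup>1\<close>, and in its translation part \<open>w\<^sub>i - Ad (k\<^sub>i k\<^sub>j\<^sup>-\<^sup>1) w\<^sub>j\<close> the two
  contributions \<open>Ad k\<^sub>i v\<close> cancel.\<close>

section \<open>The matrix exponential and its product rule for commuting exponents\<close>

interpretation matrix_mult: bounded_bilinear "(**) :: 'n::finite sqmat \<Rightarrow> 'n sqmat \<Rightarrow> 'n sqmat"
proof -
  have "bilinear ((**) :: 'n::finite sqmat \<Rightarrow> 'n sqmat \<Rightarrow> 'n sqmat)"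
    unfolding bilinear_def
    by (auto intro!: linearI simp: matrix_matrix_mult_def vec_eq_iff sum.distrib sum_distrib_left
        algebra_simps)
  then show "bounded_bilinear ((**) :: 'n::finite sqmat \<Rightarrow> 'n sqmat \<Rightarrow> 'n sqmat)"
    by (simp add: bilinear_conv_bounded_bilinear)
qed

text \<open>These are divided powers: with the factorial built in, the binomial theorem carries no
  coefficients.\<close>

definition mexp_term :: "'n::finite sqmat \<Rightarrow> nat \<Rightarrow> 'n sqmat" where
  "mexp_term A m = ((\<lambda>B. A ** B) ^^ m) (mat 1) /\<^sub>R fact m"

lemma mexp_term_0 [simp]: "mexp_term A 0 = mat 1"
  by (simp add: mexp_term_def)

lemma mult_mexp_term: "A ** mexp_term A m = real (Suc m) *\<^sub>R mexp_term A (Suc m)"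
  by (simp add: mexp_term_def matrix_mult.scaleR_right del: of_nat_Suc)

lemma mexp_term_Suc: "mexp_term A (Suc m) = (A ** mexp_term A m) /\<^sub>R real (Suc m)"
  by (simp add: mult_mexp_term del: of_nat_Suc)

lemma mexp_term_commute:
  assumes "A ** B = B ** A"
  shows "mexp_term A m ** B = B ** mexp_term A m"
proof (induction m)
  case (Suc m)
  have "A ** mexp_term A m ** B = A ** (B ** mexp_term A m)"
    by (simp add: Suc flip: matrix_mul_assoc)
  also have "\<dots> = B ** (A ** mexp_term A m)"
    by (simp add: assms matrix_mul_assoc)
  finally show ?case
    by (simp add: mexp_term_Suc matrix_mult.scaleR_left matrix_mult.scaleR_right del: of_nat_Suc)
qed simp

text \<open>The binomial theorem in divided powers. In the inductive step the factor
  \<open>A + B\<close> raises one of the two indices, with weights that add up to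
  \<open>Suc n\<close>.\<close>

lemma mexp_term_add_commuting:
  assumes comm: "A ** B = B ** A"
  shows "mexp_term (A + B) n = (\<Sum>i\<le>n. mexp_term A i ** mexp_term B (n - i))"
proof (induction n)
  case (Suc n)
  have "real (Suc n) *\<^sub>R mexp_term (A + B) (Suc n) =
      (A + B) ** (\<Sum>i\<le>n. mexp_term A i ** mexp_term B (n - i))"
    by (simp only: Suc flip: mult_mexp_term)
  also have "\<dots> = (\<Sum>i\<le>n. A ** mexp_term A i ** mexp_term B (n - i)) +
      (\<Sum>i\<le>n. B ** mexp_term A i ** mexp_term B (n - i))"
    by (simp only: matrix_mult.add_left matrix_mult.sum_right matrix_mul_assoc sum.distrib)
  \<comment> \<open>Commutation enters here, to move \<open>B\<close> past
    \<open>mexp_term A i\<close>.\<close>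
  also have "\<dots> = (\<Sum>i\<le>n. A ** mexp_term A i ** mexp_term B (n - i)) +
      (\<Sum>i\<le>n. mexp_term A i ** (B ** mexp_term B (n - i)))"
    by (simp add: mexp_term_commute[OF comm] matrix_mul_assoc)
  also have "\<dots> = (\<Sum>i\<le>n. real (Suc i) *\<^sub>R (mexp_term A (Suc i) ** mexp_term B (n - i))) +
      (\<Sum>i\<le>n. real (Suc n - i) *\<^sub>R (mexp_term A i ** mexp_term B (Suc n - i)))"
    by (simp add: mult_mexp_term Suc_diff_le matrix_mult.scaleR_left matrix_mult.scaleR_right)
  \<comment> \<open>The index shift adds a term \<open>i = 0\<close> of weight 0. The other sum
    gains \<open>i = Suc n\<close>, again of weight 0, so both run over the same range.\<close>
  also have "(\<Sum>i\<le>n. real (Suc i) *\<^sub>R (mexp_term A (Suc i) ** mexp_term B (n - i))) =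
      (\<Sum>i\<le>Suc n. real i *\<^sub>R (mexp_term A i ** mexp_term B (Suc n - i)))"
    by (subst sum.atMost_Suc_shift) simp
  also have "(\<Sum>i\<le>n. real (Suc n - i) *\<^sub>R (mexp_term A i ** mexp_term B (Suc n - i))) =
      (\<Sum>i\<le>Suc n. real (Suc n - i) *\<^sub>R (mexp_term A i ** mexp_term B (Suc n - i)))"
    by simp
  also have "(\<Sum>i\<le>Suc n. real i *\<^sub>R (mexp_term A i ** mexp_term B (Suc n - i))) +
      (\<Sum>i\<le>Suc n. real (Suc n - i) *\<^sub>R (mexp_term A i ** mexp_term B (Suc n - i))) =
      (\<Sum>i\<le>Suc n. real (Suc n) *\<^sub>R (mexp_term A i ** mexp_term B (Suc n - i)))"
    by (simp flip: sum.distrib scaleR_add_left of_nat_add)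
  also have "\<dots> = real (Suc n) *\<^sub>R (\<Sum>i\<le>Suc n. mexp_term A i ** mexp_term B (Suc n - i))"
    by (simp only: scaleR_right.sum)
  finally show ?case
    by (simp del: sum.cl_ivl_Suc)
qed simp

text \<open>An entry of a matrix product is a sum of \<open>CARD('n)\<close> products, and entries
  of \<open>A\<close> are at most \<open>norm A\<close> in absolute value. The bound is a term of a
  real exponential series.\<close>

lemma abs_mexp_term_le:
  fixes A :: "'n::finite sqmat"
  shows "\<bar>mexp_term A m $ i $ j\<bar> \<le> (real CARD('n) * norm A) ^ m / fact m"
proof (induction m arbitrary: i)
  case 0
  show ?case by (simp add: mat_def)
next
  case (Suc m)
  let ?b = "(real CARD('n) * norm A) ^ m / fact m"
  have "\<bar>(A ** mexp_term A m) $ i $ j\<bar> \<le> (\<Sum>l\<in>UNIV. \<bar>A $ i $ l\<bar> * \<bar>mexp_term A m $ l $ j\<bar>)"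
    by (simp add: matrix_matrix_mult_def sum_abs flip: abs_mult)
  also have "\<dots> \<le> (\<Sum>l\<in>(UNIV :: 'n set). norm A * ?b)"
  proof (intro sum_mono mult_mono Suc)
    show "\<bar>A $ i $ l\<bar> \<le> norm A" for l
      by (meson component_le_norm_cart Finite_Cartesian_Product.norm_nth_le order_trans)
  qed auto
  also have "\<dots> = (real CARD('n) * norm A) * ?b"
    by simp
  finally have "\<bar>(A ** mexp_term A m) $ i $ j\<bar> / real (Suc m) \<le>
      (real CARD('n) * norm A) * ?b / real (Suc m)"
    by (rule divide_right_mono) simp
  also have "\<dots> = (real CARD('n) * norm A) ^ Suc m / fact (Suc m)"
    by (simp add: mult.commute)
  finally show ?case
    by (simp add: mexp_term_Suc abs_mult divide_inverse_commute del: of_nat_Suc power_Suc fact_Suc)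
qed

lemma summable_abs_mexp_term: "summable (\<lambda>m. \<bar>mexp_term A m $ i $ j\<bar>)"
proof (rule summable_comparison_test')
  show "summable (\<lambda>m. (real CARD('a) * norm A) ^ m / fact m)"
    using summable_exp[of "real CARD('a) * norm A"] by (simp add: divide_inverse_commute)
  show "norm \<bar>mexp_term A m $ i $ j\<bar> \<le> (real CARD('a) * norm A) ^ m / fact m" for m
    using abs_mexp_term_le[of A m i j] by simp
qed

text \<open>Entrywise convergence gives convergence of the matrix series, so the infinite sum in
  \<open>mexp\<close> is a genuine limit.\<close>

lemma mexp_term_sums: "mexp_term A sums mexp A"
proof -
  have "(\<lambda>m. mexp_term A m $ i $ j) sums (\<Sum>m. mexp_term A m $ i $ j)" for i j
    by (rule summable_sums[OF summable_rabs_cancel[OF summable_abs_mexp_term]])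
  then have "mexp_term A sums (\<chi> i j. \<Sum>m. mexp_term A m $ i $ j)"
    unfolding sums_def by (auto intro!: vec_tendstoI)
  then show ?thesis
    by (simp add: mexp_def sums_iff flip: mexp_term_def)
qed

text \<open>The Cauchy product is taken on real entries: for each middle index \<open>l\<close> of
  the matrix product, two absolutely convergent real series are multiplied.\<close>

lemma mexp_add_commuting:
  assumes "A ** B = B ** A"
  shows "mexp (A + B) = mexp A ** mexp B"
proof -
  have entry: "(\<lambda>m. mexp_term X m $ i $ j) sums (mexp X $ i $ j)" for X :: "'a sqmat" and i j
    by (intro sums_vec_nth mexp_term_sums)
  have "(mexp (A + B)) $ i $ j = (mexp A ** mexp B) $ i $ j" for i j
  proof (rule sums_unique2)
    have "(\<lambda>n. \<Sum>l\<in>UNIV. \<Sum>m\<le>n. mexp_term A m $ i $ l * mexp_term B (n - m) $ l $ j) sums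
        (\<Sum>l\<in>UNIV. (mexp A $ i $ l) * (mexp B $ l $ j))"
      using Cauchy_product_sums[of "\<lambda>m. mexp_term A m $ i $ l" "\<lambda>m. mexp_term B m $ l $ j" for l]
      by (intro sums_sum) (simp add: summable_abs_mexp_term sums_unique[OF entry])
    \<comment> \<open>After the sums are exchanged, the sum over \<open>l\<close> is an entry of a
      matrix product and the binomial theorem applies.\<close>
    moreover have "(\<Sum>l\<in>UNIV. \<Sum>m\<le>n. mexp_term A m $ i $ l * mexp_term B (n - m) $ l $ j) =
        mexp_term (A + B) n $ i $ j" for n
      by (subst sum.swap) (simp add: mexp_term_add_commuting[OF assms] matrix_matrix_mult_def)
    ultimately show "(\<lambda>n. mexp_term (A + B) n $ i $ j) sums ((mexp A ** mexp B) $ i $ j)"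
      by (simp add: matrix_matrix_mult_def)
  qed (rule entry)
  then show ?thesis
    by (simp add: vec_eq_iff)
qed

lemma mexp_0 [simp]: "mexp (0 :: 'n::finite sqmat) = mat 1"
proof -
  have "mexp_term (0 :: 'n sqmat) = (\<lambda>m. if m = 0 then mat 1 else 0)"
  proof
    show "mexp_term (0 :: 'n sqmat) m = (if m = 0 then mat 1 else 0)" for m
      by (cases m) (simp_all add: mexp_term_Suc)
  qed
  then have "mexp_term (0 :: 'n sqmat) sums mat 1"
    using sums_single[of 0 "\<lambda>_. mat 1 :: 'n sqmat"] by simp
  then show ?thesis
    using mexp_term_sums sums_unique2 by blast
qed

lemma mexp_mult_uminus [simp]: "mexp A ** mexp (- A) = mat 1"
  using mexp_add_commuting[of A "- A"]
  by (simp add: matrix_mult.minus_left matrix_mult.minus_right)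

section \<open>Inverses and the adjoint action\<close>

lemma matrix_inv_eqI:
  fixes A B :: "'n::finite sqmat"
  assumes "A ** B = mat 1"
  shows "matrix_inv A = B"
proof -
  have BA: "B ** A = mat 1"
    using assms matrix_left_right_inverse by blast
  \<comment> \<open>\<open>matrix_inv\<close> chooses some two-sided inverse; \<open>B\<close>
    witnesses that one exists, and uniqueness then identifies the two.\<close>
  have "A ** matrix_inv A = mat 1 \<and> matrix_inv A ** A = mat 1"
    unfolding matrix_inv_def by (rule someI[of _ B]) (simp add: assms BA)
  then show ?thesis
    by (metis BA matrix_mul_assoc matrix_mul_lid matrix_mul_rid)
qed

lemma orthogonal_matrix_mult_inv [simp]:
  fixes A :: "'n::finite sqmat"
  assumes "orthogonal_matrix A"
  shows "A ** matrix_inv A = mat 1" "matrix_inv A ** A = mat 1"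
proof -
  have "A ** transpose A = mat 1" "transpose A ** A = mat 1"
    using assms by (auto simp: orthogonal_matrix_def)
  then show "A ** matrix_inv A = mat 1" "matrix_inv A ** A = mat 1"
    by (simp_all add: matrix_inv_eqI)
qed

lemma matrix_inv_mult:
  fixes A B :: "'n::finite sqmat"
  assumes "orthogonal_matrix A" "orthogonal_matrix B"
  shows "matrix_inv (A ** B) = matrix_inv B ** matrix_inv A"
proof (rule matrix_inv_eqI)
  have "A ** B ** (matrix_inv B ** matrix_inv A) = A ** (B ** matrix_inv B) ** matrix_inv A"
    by (simp only: matrix_mul_assoc)
  then show "A ** B ** (matrix_inv B ** matrix_inv A) = mat 1"
    using assms by simp
qed

lemma Ad_add: "Ad k (x + y) = Ad k x + Ad k y"
  by (simp add: Ad_def matrix_mult.add_left matrix_mult.add_right)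

lemma Ad_uminus: "Ad k (- x) = - Ad k x"
  by (simp add: Ad_def matrix_mult.minus_left matrix_mult.minus_right)

lemma Ad_scaleR: "Ad k (c *\<^sub>R x) = c *\<^sub>R Ad k x"
  by (simp add: Ad_def matrix_mult.scaleR_left matrix_mult.scaleR_right)

lemma Ad_mult:
  assumes "orthogonal_matrix k" "orthogonal_matrix l"
  shows "Ad (k ** l) x = Ad k (Ad l x)"
  by (simp add: Ad_def matrix_inv_mult[OF assms] matrix_mul_assoc)

lemma Ad_mat_1 [simp]: "Ad (mat 1) x = x"
  by (simp add: Ad_def matrix_inv_eqI[of "mat 1" "mat 1"])

lemma Ad_mexp_term:
  assumes "orthogonal_matrix k"
  shows "mexp_term (Ad k x) m = Ad k (mexp_term x m)"
proof (induction m)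
  case 0
  then show ?case using assms by (simp add: Ad_def)
next
  case (Suc m)
  have "Ad k x ** Ad k (mexp_term x m) =
      k ** x ** (matrix_inv k ** k) ** mexp_term x m ** matrix_inv k"
    by (simp only: Ad_def matrix_mul_assoc)
  also have "\<dots> = Ad k (x ** mexp_term x m)"
    using assms by (simp add: Ad_def matrix_mul_assoc)
  finally show ?case
    by (simp add: mexp_term_Suc Suc Ad_scaleR del: of_nat_Suc)
qed

text \<open>Conjugation respects products, so it acts term by term; being linear in finite dimension
  it is continuous and passes through the series.\<close>

lemma mexp_Ad:
  assumes "orthogonal_matrix k"
  shows "mexp (Ad k x) = Ad k (mexp x)"
proof (rule sums_unique2[OF mexp_term_sums])
  have "bounded_linear (Ad k)"
    by (auto intro!: linearI simp: Ad_add Ad_scaleR simp flip: linear_conv_bounded_linear)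
  from bounded_linear.sums[OF this mexp_term_sums]
  show "mexp_term (Ad k x) sums Ad k (mexp x)"
    by (simp flip: Ad_mexp_term[OF assms])
qed

lemma mult_mexp_eq:
  assumes "orthogonal_matrix k"
  shows "k ** mexp x = mexp (Ad k x) ** k"
proof -
  have "mexp (Ad k x) ** k = k ** mexp x ** (matrix_inv k ** k)"
    unfolding mexp_Ad[OF assms] by (simp only: Ad_def matrix_mul_assoc)
  then show ?thesis
    using assms by simp
qed

section \<open>Cartan decompositions of products and inverses\<close>

lemma cartan_product:
  assumes "orthogonal_matrix k" "lie_bracket (Ad k x) y = 0"
  shows "mexp y ** k ** (mexp x ** l) = mexp (y + Ad k x) ** (k ** l)"
proof -
  have "mexp y ** k ** (mexp x ** l) = mexp y ** (k ** mexp x) ** l"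
    by (simp only: matrix_mul_assoc)
  also have "\<dots> = mexp y ** mexp (Ad k x) ** (k ** l)"
    by (simp only: mult_mexp_eq[OF assms(1)] matrix_mul_assoc)
  also have "mexp y ** mexp (Ad k x) = mexp (y + Ad k x)"
    using assms(2) by (simp add: mexp_add_commuting lie_bracket_def)
  finally show ?thesis .
qed

text \<open>Inversion yields \<open>matrix_inv k ** mexp (- w)\<close>, and moving the rotation to
  the right restores the Cartan form. The resulting pair has the same shape as the inverse in the
  motion group.\<close>

lemma cartan_inverse:
  assumes "orthogonal_matrix k" "orthogonal_matrix (matrix_inv k)"
  shows "matrix_inv (mexp w ** k) = mexp (- Ad (matrix_inv k) w) ** matrix_inv k"
proof (rule matrix_inv_eqI)
  have "mexp w ** k ** (mexp (- Ad (matrix_inv k) w) ** matrix_inv k) =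
      mexp w ** k ** (matrix_inv k ** mexp (- w))"
    by (simp add: mult_mexp_eq[OF assms(2)] Ad_uminus)
  also have "\<dots> = mexp w ** (k ** matrix_inv k) ** mexp (- w)"
    by (simp only: matrix_mul_assoc)
  also have "\<dots> = mat 1"
    using assms(1) by simp
  finally show "mexp w ** k ** (mexp (- Ad (matrix_inv k) w) ** matrix_inv k) = mat 1" .
qed

section \<open>Closure properties of \<open>\<pp>\<close>\<close>

lemma lie_algebra_of_add_commuting:
  assumes G: "orthogonal_matrix_group G" and X: "X \<in> lie_algebra_of G" and Y: "Y \<in> lie_algebra_of G"
    and comm: "X ** Y = Y ** X"
  shows "X + Y \<in> lie_algebra_of G"
proof -
  \<comment> \<open>The product of two commuting one-parameter groups is again a one-parameter
    group.\<close>
  have "mexp (t *\<^sub>R (X + Y)) = mexp (t *\<^sub>R X) ** mexp (t *\<^sub>R Y)" for t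
    unfolding scaleR_add_right
    by (rule mexp_add_commuting) (simp add: matrix_mult.scaleR_left matrix_mult.scaleR_right comm)
  then show ?thesis
    using G X Y by (auto simp: lie_algebra_of_def orthogonal_matrix_group_def)
qed

lemma lie_algebra_of_scaleR:
  assumes "X \<in> lie_algebra_of G"
  shows "c *\<^sub>R X \<in> lie_algebra_of G"
  using assms by (simp add: lie_algebra_of_def)

text \<open>The commutation hypothesis spares the Lie product formula, which the closure of
  \<open>lie_algebra_of G\<close> under arbitrary sums would require.\<close>

lemma cartan_setting_add_commuting:
  assumes "cartan_setting G \<tt> \<pp> K" "x \<in> \<pp>" "y \<in> \<pp>" "x ** y = y ** x"
  shows "x + y \<in> \<pp>"
proof -
  have "orthogonal_matrix_group G"
    using assms(1) by (simp add: cartan_setting_def semisimple_compact_group_def)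
  moreover obtain \<theta> where "cartan_involution (lie_algebra_of G) \<theta>"
      "\<pp> = {X \<in> lie_algebra_of G. \<theta> X = - X}"
    using assms(1) by (auto simp: cartan_setting_def cartan_decomp_def)
  ultimately show ?thesis
    using assms(2-) lie_algebra_of_add_commuting[of G x y] by (auto simp: cartan_involution_def)
qed

lemma cartan_setting_scaleR:
  assumes "cartan_setting G \<tt> \<pp> K" "x \<in> \<pp>"
  shows "c *\<^sub>R x \<in> \<pp>"
proof -
  obtain \<theta> where "cartan_involution (lie_algebra_of G) \<theta>"
      "\<pp> = {X \<in> lie_algebra_of G. \<theta> X = - X}"
    using assms(1) by (auto simp: cartan_setting_def cartan_decomp_def)
  then show ?thesis
    using assms(2) lie_algebra_of_scaleR[of x G c] by (auto simp: cartan_involution_def)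
qed

section \<open>The motion group and the single-valued back map\<close>

lemma motion_group_mult:
  "(k, x) \<otimes>\<^bsub>motion_group K \<pp>\<^esub> (l, y) = (k ** l, x + Ad k y)"
  by (simp add: motion_group_def)

text \<open>\<open>inv\<close> is a definite description over the carrier, so existence and
  uniqueness are both checked. The last hypothesis puts the candidate into the carrier; being a
  right inverse already fixes both components.\<close>

lemma motion_group_inv:
  assumes K: "orthogonal_matrix_group K" and k: "k \<in> K"
    and \<pp>: "- Ad (matrix_inv k) x \<in> \<pp>"
  shows "inv\<^bsub>motion_group K \<pp>\<^esub> (k, x) = (matrix_inv k, - Ad (matrix_inv k) x)"
  unfolding m_inv_def
proof (rule the_equality)
  have orth: "orthogonal_matrix k" "orthogonal_matrix (matrix_inv k)" and inv: "matrix_inv k \<in> K"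
    using K k by (auto simp: orthogonal_matrix_group_def)
  have Ad_inv: "Ad k (Ad (matrix_inv k) y) = y" "Ad (matrix_inv k) (Ad k y) = y" for y
    using orth by (simp_all flip: Ad_mult)
  show "(matrix_inv k, - Ad (matrix_inv k) x) \<in> carrier (motion_group K \<pp>) \<and>
      (k, x) \<otimes>\<^bsub>motion_group K \<pp>\<^esub> (matrix_inv k, - Ad (matrix_inv k) x) = \<one>\<^bsub>motion_group K \<pp>\<^esub> \<and>
      (matrix_inv k, - Ad (matrix_inv k) x) \<otimes>\<^bsub>motion_group K \<pp>\<^esub> (k, x) = \<one>\<^bsub>motion_group K \<pp>\<^esub>"
    using orth inv \<pp> by (simp add: motion_group_def Ad_uminus Ad_inv)
  fix z
  assume "z \<in> carrier (motion_group K \<pp>) \<and>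
      (k, x) \<otimes>\<^bsub>motion_group K \<pp>\<^esub> z = \<one>\<^bsub>motion_group K \<pp>\<^esub> \<and>
      z \<otimes>\<^bsub>motion_group K \<pp>\<^esub> (k, x) = \<one>\<^bsub>motion_group K \<pp>\<^esub>"
  then obtain l y where z: "z = (l, y)" "k ** l = mat 1" "x + Ad k y = 0"
    by (cases z) (auto simp: motion_group_def)
  then have "Ad k y = - x"
    by (simp add: add_eq_0_iff)
  then have "y = - Ad (matrix_inv k) x"
    using Ad_inv(2)[of y] by (simp add: Ad_uminus)
  then show "z = (matrix_inv k, - Ad (matrix_inv k) x)"
    using z matrix_inv_eqI by auto
qed

text \<open>Scaling by \<open>lam\<close> is undone inside \<open>contraction_map\<close>, so the
  injectivity given by \<open>cartan_domain\<close> carries over to the scaled region.\<close>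

lemma back_map_eq:
  assumes U: "cartan_domain K \<pp> U" and lam: "lam \<noteq> 0" and k: "k \<in> K" and w: "w \<in> U"
  shows "back_map K U lam (mexp w ** k) = (k, lam *\<^sub>R w)"
  unfolding back_map_def
proof (rule the_inv_into_f_eq)
  have "inj_on (\<lambda>(k, w). mexp w ** k) (K \<times> U)"
    using U by (simp add: cartan_domain_def)
  then show "inj_on (contraction_map lam) (K \<times> (\<lambda>w. lam *\<^sub>R w) ` U)"
    using lam by (fastforce simp: inj_on_def contraction_map_def)
  show "contraction_map lam (k, lam *\<^sub>R w) = mexp w ** k"
    using lam by (simp add: contraction_map_def)
  show "(k, lam *\<^sub>R w) \<in> K \<times> (\<lambda>w. lam *\<^sub>R w) ` U"
    using k w by blast
qed

text \<open>The two conjuncts treat the single-valued and the multivalued inverse. In the second,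
  \<open>r\<close> and \<open>s\<close> are chosen once per index, not anew for each pair.\<close>

theorem proposition4p1:
  fixes G K \<tt> \<pp> :: "'n::finite sqmat set" and lam :: real and n :: nat
    and Q v k :: "nat \<Rightarrow> 'n sqmat" and Q0 v0 k0 :: "'n sqmat"
  assumes "cartan_setting G \<tt> \<pp> K" and "lam \<ge> 1"
    and "\<forall>i\<in>{1..n}. Q i \<in> G \<and> v i \<in> \<pp> \<and> k i \<in> K \<and> Q i = mexp (v i) ** k i"
    and "Q0 \<in> G" and "v0 \<in> \<pp>" and "k0 \<in> K" and "Q0 = mexp v0 ** k0"
    and "\<forall>i\<in>{1..n}. lie_bracket (Ad (k i) v0) (v i) = 0"
  shows
    "(\<forall>U. cartan_domain K \<pp> U \<and> (\<forall>i\<in>{1..n}. v i \<in> U \<and> v i + Ad (k i) v0 \<in> U) \<longrightarrow>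
        (\<forall>i\<in>{1..n}. \<forall>j\<in>{1..n}.
           back_map K U lam (Q i ** Q0)
             \<otimes>\<^bsub>motion_group K \<pp>\<^esub> back_map K U lam (matrix_inv (Q j ** Q0)) =
           back_map K U lam (Q i)
             \<otimes>\<^bsub>motion_group K \<pp>\<^esub> inv\<^bsub>motion_group K \<pp>\<^esub> (back_map K U lam (Q j)))) \<and>
     (\<exists>r s. (\<forall>i\<in>{1..n}. r i \<in> back_values K \<pp> lam (Q i ** Q0) \<and>
                          s i \<in> back_values K \<pp> lam (matrix_inv (Q i ** Q0))) \<and>
        (\<forall>i\<in>{1..n}. \<forall>j\<in>{1..n}.
           r i \<otimes>\<^bsub>motion_group K \<pp>\<^esub> s j =
           (k i, lam *\<^sub>R v i)
             \<otimes>\<^bsub>motion_group K \<pp>\<^esub> inv\<^bsub>motion_group K \<pp>\<^esub> (k j, lam *\<^sub>R v j)))"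
proof -
  define w where "w i = v i + Ad (k i) v0" for i
  define h where "h i = k i ** k0" for i
  \<comment> \<open>The translation part of the inverse of \<open>(h i, w i)\<close>, as in
    \<open>cartan_inverse\<close>.\<close>
  define w' where "w' i = - Ad (matrix_inv (h i)) (w i)" for i
  have lam: "lam \<noteq> 0"
    using assms(2) by simp
  have K: "orthogonal_matrix_group K" and AdK: "\<And>k v. k \<in> K \<Longrightarrow> v \<in> \<pp> \<Longrightarrow> Ad k v \<in> \<pp>"
    using assms(1) by (auto simp: cartan_setting_def)
  have orth: "orthogonal_matrix a" and invK: "matrix_inv a \<in> K" if "a \<in> K" for a
    using K that by (auto simp: orthogonal_matrix_group_def)
  have minus\<pp>: "- x \<in> \<pp>" if "x \<in> \<pp>" for x
    using cartan_setting_scaleR[OF assms(1) that, of "-1"] by simp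
  have ki: "k i \<in> K" and vi: "v i \<in> \<pp>" and Qi: "Q i = mexp (v i) ** k i"
    and bracket: "lie_bracket (Ad (k i) v0) (v i) = 0" if "i \<in> {1..n}" for i
    using assms(3,8) that by auto
  have hi: "h i \<in> K" if "i \<in> {1..n}" for i
    using K ki[OF that] assms(6) by (auto simp: h_def orthogonal_matrix_group_def)
  \<comment> \<open>The bracket hypothesis serves twice: here for membership in
    \<open>\<pp>\<close>, and in \<open>prod\<close> to merge two exponentials.\<close>
  have wi: "w i \<in> \<pp>" if "i \<in> {1..n}" for i
    unfolding w_def using that bracket[OF that]
    by (intro cartan_setting_add_commuting[OF assms(1)] vi AdK ki assms(5))
      (simp_all add: lie_bracket_def)
  have w'i: "w' i \<in> \<pp>" if "i \<in> {1..n}" for i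
    unfolding w'_def by (intro minus\<pp> AdK invK hi wi that)
  have prod: "Q i ** Q0 = mexp (w i) ** h i" if "i \<in> {1..n}" for i
    unfolding w_def h_def Qi[OF that] assms(7)
    by (intro cartan_product orth ki bracket that)
  have inverse: "matrix_inv (Q i ** Q0) = mexp (w' i) ** matrix_inv (h i)" if "i \<in> {1..n}" for i
    unfolding w'_def prod[OF that] by (intro cartan_inverse orth invK hi that)
  \<comment> \<open>Both conjuncts reduce to this identity, which lies entirely in the motion
    group.\<close>
  have ratio: "(h i, lam *\<^sub>R w i) \<otimes>\<^bsub>motion_group K \<pp>\<^esub> (matrix_inv (h j), lam *\<^sub>R w' j) =
      (k i, lam *\<^sub>R v i) \<otimes>\<^bsub>motion_group K \<pp>\<^esub> inv\<^bsub>motion_group K \<pp>\<^esub> (k j, lam *\<^sub>R v j)"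
    if i: "i \<in> {1..n}" and j: "j \<in> {1..n}" for i j
  proof -
    have o: "orthogonal_matrix (k i)" "orthogonal_matrix (k j)" "orthogonal_matrix k0"
        "orthogonal_matrix (matrix_inv (k j))" "orthogonal_matrix (matrix_inv k0)"
        "orthogonal_matrix (matrix_inv (h j))" "orthogonal_matrix (h i)"
      using ki[OF i] ki[OF j] hi[OF i] hi[OF j] assms(6) by (auto intro: orth invK)
    have "h i ** matrix_inv (h j) = k i ** (k0 ** matrix_inv k0) ** matrix_inv (k j)"
      using o by (simp only: h_def matrix_inv_mult matrix_mul_assoc)
    also have "\<dots> = k i ** matrix_inv (k j)"
      using o by simp
    finally have rot: "h i ** matrix_inv (h j) = k i ** matrix_inv (k j)" .
    have "Ad (h i) (w' j) = - Ad (h i ** matrix_inv (h j)) (w j)"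
      using o by (simp add: w'_def Ad_uminus Ad_mult)
    \<comment> \<open>The action of \<open>k j\<close> on \<open>v0\<close> is undone, so the
      alignment contributes \<open>Ad (k i) v0\<close> for every \<open>j\<close>, which is its
      contribution to \<open>w i\<close>.\<close>
    also have "\<dots> = - Ad (k i) (Ad (matrix_inv (k j)) (v j)) - Ad (k i) (Ad (matrix_inv (k j) ** k j) v0)"
      using o by (simp only: rot w_def Ad_mult Ad_add) simp
    also have "\<dots> = - Ad (k i) (Ad (matrix_inv (k j)) (v j)) - Ad (k i) v0"
      using o by simp
    finally have trans: "w i + Ad (h i) (w' j) = v i - Ad (k i) (Ad (matrix_inv (k j)) (v j))"
      by (simp add: w_def)
    have "- Ad (matrix_inv (k j)) (lam *\<^sub>R v j) \<in> \<pp>"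
      by (intro minus\<pp> AdK invK ki cartan_setting_scaleR[OF assms(1)] vi j)
    then have "inv\<^bsub>motion_group K \<pp>\<^esub> (k j, lam *\<^sub>R v j) =
        (matrix_inv (k j), - Ad (matrix_inv (k j)) (lam *\<^sub>R v j))"
      by (intro motion_group_inv K ki j)
    then show ?thesis
      using arg_cong[OF trans, of "scaleR lam"]
      by (simp add: motion_group_mult rot Ad_uminus Ad_scaleR scaleR_add_right scaleR_diff_right)
  qed
  show ?thesis
  proof (intro conjI allI impI ballI exI)
    fix U i j
    assume U: "cartan_domain K \<pp> U \<and> (\<forall>i\<in>{1..n}. v i \<in> U \<and> v i + Ad (k i) v0 \<in> U)"
      and i: "i \<in> {1..n}" and j: "j \<in> {1..n}"
    have dom: "cartan_domain K \<pp> U"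
      using U by blast
    have U_vw: "v l \<in> U" "w l \<in> U" if "l \<in> {1..n}" for l
      using U that by (auto simp: w_def)
    \<comment> \<open>This is where the symmetry of \<open>U\<close> under negation and under
      \<open>Ad\<close> of \<open>K\<close> is used.\<close>
    have "w' j \<in> U"
      using dom U_vw(2)[OF j] invK[OF hi[OF j]] by (auto simp: cartan_domain_def w'_def)
    then show "back_map K U lam (Q i ** Q0)
          \<otimes>\<^bsub>motion_group K \<pp>\<^esub> back_map K U lam (matrix_inv (Q j ** Q0)) =
        back_map K U lam (Q i)
          \<otimes>\<^bsub>motion_group K \<pp>\<^esub> inv\<^bsub>motion_group K \<pp>\<^esub> (back_map K U lam (Q j))"
      unfolding prod[OF i] inverse[OF j]
      unfolding Qi[OF i] Qi[OF j]
      using ki[OF i] ki[OF j] hi[OF i] invK[OF hi[OF j]] U_vw[OF i] U_vw[OF j]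
      by (simp add: back_map_eq[OF dom lam] ratio[OF i j])
  next
    fix i assume i: "i \<in> {1..n}"
    \<comment> \<open>This goal and the next one fix the witnesses \<open>r\<close> and
      \<open>s\<close>.\<close>
    show "(h i, lam *\<^sub>R w i) \<in> back_values K \<pp> lam (Q i ** Q0)"
      using hi[OF i] wi[OF i] prod[OF i] by (auto simp: back_values_def)
    show "(matrix_inv (h i), lam *\<^sub>R w' i) \<in> back_values K \<pp> lam (matrix_inv (Q i ** Q0))"
      using invK[OF hi[OF i]] w'i[OF i] inverse[OF i] by (auto simp: back_values_def)
  qed (rule ratio)
qed

end
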